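(* Let $a,b \geq 0$ be integers. Then $$c(D_{a,b}) = f(a,b) + \beta(a,b)\, c(D_{a-1,b}) + \beta(b,a)\, c(D_{a,b-1}),$$ where $f(a,b) = c(K_{1,a} \coprod K_{1,b}) = \binom{2a+2b+2}{2a+1}\, 2^a (a!)^2\, 2^b (b!)^2$ and $\beta(a,b) := a(2a+2b+2)$ (a term whose coefficient $\beta$ is $0$ is read as $0$).
   Context: Graphs are finite, simple and undirected. The elements of a graph $G=(V,E)$ are the members of $V \cup E$. A construction sequence (c-sequence) for $G$ is a listing of all the elements of $G$, without repetitions, such that each edge appears after both of its endpoints. The construction number $c(G)$ is the number of distinct construction sequences for $G$. $K_{1,n}$ is the star with one hub vertex adjacent to $n$ other vertices ($n \ge 0$) and no further edges; $\coprod$ denotes disjoint union of graphs. For $a,b\ge 0$, the double star $D_{a,b}$ is the tree consisting of two adjacent vertices $v$ and $w$, where $v$ is adjacent to $a$ and $w$ to $b$ additional vertices, and all vertices other than $v$ and $w$ have degree 1. *)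

theory Defs
  imports Complex_Main
begin

text \<open>A graph is a pair of a vertex set and an edge set, an edge being the two-element set of its
  endpoints. The elements of \<open>V \<union> E\<close> are tagged by a sum type, so that vertices and
  edges share one list.\<close>

type_synonym 'v graph = "'v set \<times> 'v set set"

definition simple_graph :: "'v graph \<Rightarrow> bool" where
  "simple_graph G \<longleftrightarrow> finite (fst G) \<and> (\<forall>e\<in>snd G. e \<subseteq> fst G \<and> card e = 2)"

definition elements :: "'v graph \<Rightarrow> ('v + 'v set) set" where
  "elements G = fst G <+> snd G"

definition construction_sequence :: "'v graph \<Rightarrow> ('v + 'v set) list \<Rightarrow> bool" where
  "construction_sequence G xs \<longleftrightarrow>
     distinct xs \<and> set xs = elements G \<and>
     (\<forall>i<length xs. \<forall>j<length xs. \<forall>v e.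
        xs ! i = Inl v \<longrightarrow> xs ! j = Inr e \<longrightarrow> v \<in> e \<longrightarrow> i < j)"

definition construction_number :: "'v graph \<Rightarrow> nat" where
  "construction_number G = card {xs. construction_sequence G xs}"

definition disjoint_union :: "'v graph \<Rightarrow> 'w graph \<Rightarrow> ('v + 'w) graph" where
  "disjoint_union G H =
     (fst G <+> fst H, (\<lambda>e. Inl ` e) ` snd G \<union> (\<lambda>e. Inr ` e) ` snd H)"

datatype star_vertex = Hub | Leaf nat

definition star :: "nat \<Rightarrow> star_vertex graph" where
  "star n = (insert Hub (Leaf ` {..<n}), {{Hub, Leaf i} | i. i < n})"

datatype double_star_vertex = HubV | HubW | LeafV nat | LeafW nat

definition double_star :: "nat \<Rightarrow> nat \<Rightarrow> double_star_vertex graph" where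
  "double_star a b =
     ({HubV, HubW} \<union> LeafV ` {..<a} \<union> LeafW ` {..<b},
      {{HubV, HubW}} \<union> {{HubV, LeafV i} | i. i < a} \<union> {{HubW, LeafW i} | i. i < b})"

text \<open>Since \<open>beta 0 b = 0\<close>, the truncated subtraction in \<open>beta a b * construction_number (double_star (a - 1) b)\<close>
  is harmless for \<open>a = 0\<close>: the product is then 0.\<close>

definition beta :: "nat \<Rightarrow> nat \<Rightarrow> nat" where
  "beta a b = a * (2 * a + 2 * b + 2)"

lemma simple_graph_star: "simple_graph (star n)"
  by (auto simp: simple_graph_def star_def)

lemma simple_graph_double_star: "simple_graph (double_star a b)"
  by (auto simp: simple_graph_def double_star_def)

lemma simple_graph_disjoint_union:
  assumes "simple_graph G" "simple_graph H"
  shows "simple_graph (disjoint_union G H)"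
  using assms by (auto simp: simple_graph_def disjoint_union_def card_image)

lemma finite_construction_sequences:
  assumes "simple_graph G"
  shows "finite {xs. construction_sequence G xs}"
proof -
  have "finite (snd G)"
    by (rule finite_subset[of _ "Pow (fst G)"]) (use assms in \<open>auto simp: simple_graph_def\<close>)
  then have "finite (elements G)"
    using assms by (simp add: elements_def simple_graph_def)
  then have "finite {xs. set xs = elements G \<and> distinct xs}"
    by (rule rev_finite_subset[OF finite_subset_distinct]) auto
  then show ?thesis
    by (rule rev_finite_subset) (auto simp: construction_sequence_def)
qed

end

theory Submission
  imports Defs
begin

text \<open>
  In a non-empty graph without isolated vertices every vertex is followed by an edge, so a construction
  sequence ends with an edge. Deleting that edge leaves a construction sequence of the graph without
  it, and conversely any edge may be put last. Hence the construction number is the sum, over all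
  edges, of the construction numbers of the edge-deleted graphs
  (\<open>construction_number_last_edge\<close>).

  For the double star there are three kinds of last edge. Without the hub edge, two disjoint stars
  remain. Without the edge at a leaf, that leaf becomes an isolated vertex beside a smaller double star
  with \<open>2 * a + 2 * b + 1\<close> elements; an isolated vertex is unconstrained, so it can be
  inserted at any of \<open>2 * a + 2 * b + 2\<close> places. The leaves at one hub contribute equally,
  which gives the factors \<open>beta a b\<close> and \<open>beta b a\<close>.

  The closed form for two stars comes from interleaving: the construction sequences of a
  vertex-disjoint union are exactly the shuffles of construction sequences of the parts, whence the
  binomial coefficient (\<open>construction_number_vertex_disjoint_union\<close>). An isolated vertex
  is the special case in which one part is a single vertex. For one star with \<open>n\<close> leaves the
  last-edge principle yields \<open>c n = n * (2 * n) * c (n - 1)\<close>, so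
  \<open>c n = 2 ^ n * (fact n)\<^sup>2\<close>.
\<close>

section \<open>Construction sequences as sorted lists\<close>

definition endpoint :: "'v + 'v set \<Rightarrow> 'v + 'v set \<Rightarrow> bool" where
  "endpoint x y \<longleftrightarrow> (\<exists>v e. x = Inl v \<and> y = Inr e \<and> v \<in> e)"

text \<open>The condition on pairs of positions becomes a forbidden-pattern condition: no edge
  stands before one of its endpoints. In this form it passes directly to sublists, appended
  lists, shuffles and images.\<close>

lemma construction_sequence_iff_sorted:
  "construction_sequence G xs \<longleftrightarrow>
     distinct xs \<and> set xs = elements G \<and> sorted_wrt (\<lambda>x y. \<not> endpoint y x) xs"
proof -
  have "(\<forall>i<length xs. \<forall>j<length xs. \<forall>v e.
            xs ! i = Inl v \<longrightarrow> xs ! j = Inr e \<longrightarrow> v \<in> e \<longrightarrow> i < j) \<longleftrightarrow>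
          sorted_wrt (\<lambda>x y. \<not> endpoint y x) xs" (is "?L \<longleftrightarrow> ?R")
  proof
    assume ?L
    then show ?R
      unfolding sorted_wrt_iff_nth_less endpoint_def
      by (metis order.strict_trans order_less_irrefl)
  next
    assume R: ?R
    show ?L
    proof (intro allI impI)
      fix i j v e
      assume *: "i < length xs" "j < length xs" "xs ! i = Inl v" "xs ! j = Inr e" "v \<in> e"
      then have "endpoint (xs ! i) (xs ! j)" "i \<noteq> j"
        by (auto simp: endpoint_def)
      then show "i < j"
        using R * unfolding sorted_wrt_iff_nth_less by (meson linorder_neqE_nat)
    qed
  qed
  then show ?thesis
    by (simp add: construction_sequence_def)
qed

lemma finite_edges: "simple_graph G \<Longrightarrow> finite (snd G)"
  by (rule finite_subset[of _ "Pow (fst G)"]) (auto simp: simple_graph_def)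

lemma length_construction_sequence:
  assumes "simple_graph G" "construction_sequence G xs"
  shows "length xs = card (fst G) + card (snd G)"
proof -
  have "length xs = card (elements G)"
    using assms by (metis construction_sequence_def distinct_card)
  then show ?thesis
    using assms finite_edges[of G] by (simp add: elements_def card_Plus simple_graph_def)
qed

section \<open>Three counting principles\<close>

text \<open>Renaming the vertices injectively, and the edges along with them, maps the construction
  sequences of one graph bijectively to those of the other.\<close>

lemma construction_number_image:
  assumes inj: "inj_on f V" and sub: "\<And>e. e \<in> E \<Longrightarrow> e \<subseteq> V"
  shows "construction_number (f ` V, (`) f ` E) = construction_number (V, E)"
proof -
  define F where "F = map_sum f ((`) f)"
  let ?S = "elements (V, E)"
  have im: "elements (f ` V, (`) f ` E) = F ` ?S"
    by (force simp: F_def elements_def)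
  have injF: "inj_on F ?S"
    using inj inj_on_image_eq_iff[OF inj] sub
    by (auto simp: F_def elements_def inj_on_def[of "map_sum f ((`) f)"] dest: inj_onD)
  have ep: "endpoint (F x) (F y) \<longleftrightarrow> endpoint x y" if "x \<in> ?S" "y \<in> ?S" for x y
    using that
    by (auto simp: F_def endpoint_def elements_def) (metis inj inj_onD sub subsetD)
  have srt: "sorted_wrt (\<lambda>x y. \<not> endpoint y x) (map F xs) \<longleftrightarrow>
      sorted_wrt (\<lambda>x y. \<not> endpoint y x) xs" if "set xs \<subseteq> ?S" for xs
  proof -
    have "endpoint (F (xs ! j)) (F (xs ! i)) = endpoint (xs ! j) (xs ! i)"
      if "i < j" "j < length xs" for i j
      using \<open>set xs \<subseteq> ?S\<close> that by (intro ep) auto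
    then show ?thesis
      by (auto simp: sorted_wrt_iff_nth_less)
  qed
  have dst: "distinct (map F xs) \<longleftrightarrow> distinct xs" if "set xs \<subseteq> ?S" for xs
    using inj_on_subset[OF injF that] by (simp add: distinct_map)
  have "{ys. construction_sequence (f ` V, (`) f ` E) ys} =
      map F ` {xs. construction_sequence (V, E) xs}" (is "?A = ?B")
  proof
    show "?A \<subseteq> ?B"
    proof
      fix ys assume ys: "ys \<in> ?A"
      then have "ys \<in> lists (F ` ?S)"
        by (auto simp: construction_sequence_iff_sorted im)
      then obtain xs where xs: "ys = map F xs" "set xs \<subseteq> ?S"
        by (auto simp: lists_image)
      have "set xs = ?S"
        using ys xs inj_on_image_eq_iff[OF injF, of "set xs" ?S]
        by (simp add: construction_sequence_iff_sorted im)
      then show "ys \<in> ?B"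
        using ys xs by (auto simp: construction_sequence_iff_sorted srt dst)
    qed
    show "?B \<subseteq> ?A"
      by (auto simp: construction_sequence_iff_sorted im srt dst)
  qed
  moreover have "inj_on (map F) {xs. construction_sequence (V, E) xs}"
    by (rule inj_on_subset[OF inj_on_mapI[of F "{xs. set xs = ?S}"]])
      (use injF in \<open>auto simp: construction_sequence_iff_sorted intro: inj_on_subset\<close>)
  ultimately show ?thesis
    by (simp add: construction_number_def card_image)
qed

lemma sorted_wrt_shuffles:
  assumes "zs \<in> shuffles xs ys" "sorted_wrt P xs" "sorted_wrt P ys"
    and "\<And>x y. x \<in> set xs \<Longrightarrow> y \<in> set ys \<Longrightarrow> P x y \<and> P y x"
  shows "sorted_wrt P zs"
  using assms
proof (induction zs arbitrary: xs ys)
  case (Cons z zs)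
  from Cons.prems(1) consider
    xs' where "xs = z # xs'" "zs \<in> shuffles xs' ys" | ys' where "ys = z # ys'" "zs \<in> shuffles xs ys'"
    by (metis Cons_in_shuffles_iff list.collapse)
  then show ?case
  proof cases
    case (1 xs')
    with Cons.prems Cons.IH[of xs' ys] show ?thesis
      by (auto simp: set_shuffles)
  next
    case (2 ys')
    with Cons.prems Cons.IH[of xs ys'] show ?thesis
      by (auto simp: set_shuffles)
  qed
qed simp

text \<open>No element of one part is an endpoint of an element of the other, so the parts can be
  interleaved freely; filtering recovers the two sequences from a shuffle, so nothing is counted
  twice. Two sequences of lengths \<open>m\<close> and \<open>n\<close> without common entries have
  \<open>(m + n) choose m\<close> shuffles.\<close>

lemma construction_number_vertex_disjoint_union:
  assumes G: "simple_graph (V, E)" and H: "simple_graph (V', E')" and disj: "V \<inter> V' = {}"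
  shows "construction_number (V \<union> V', E \<union> E') =
     ((card V + card E + card V' + card E') choose (card V + card E))
     * construction_number (V, E) * construction_number (V', E')"
proof -
  let ?C = "{xs. construction_sequence (V, E) xs}" and ?D = "{ys. construction_sequence (V', E') ys}"
  let ?S = "elements (V, E)" and ?T = "elements (V', E')"
  let ?N = "(card V + card E + card V' + card E') choose (card V + card E)"
  have sub: "e \<subseteq> V \<and> e \<noteq> {}" if "e \<in> E" for e
    using G that by (auto simp: simple_graph_def)
  have sub': "e \<subseteq> V' \<and> e \<noteq> {}" if "e \<in> E'" for e
    using H that by (auto simp: simple_graph_def)
  \<comment> \<open>an edge common to both parts would have no endpoints\<close>
  have ST: "?S \<inter> ?T = {}"
    using disj sub sub' by (fastforce simp: elements_def)
  have un: "elements (V \<union> V', E \<union> E') = ?S \<union> ?T"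
    by (auto simp: elements_def)
  have cross: "\<not> endpoint x y \<and> \<not> endpoint y x" if "x \<in> ?S" "y \<in> ?T" for x y
    using that disj sub sub' by (fastforce simp: elements_def endpoint_def)
  have filt: "filter (\<lambda>x. x \<in> ?S) zs = xs" "filter (\<lambda>x. x \<notin> ?S) zs = ys"
    if "zs \<in> shuffles xs ys" "set xs = ?S" "set ys = ?T" for xs ys zs
    using that ST filter_shuffles_disjoint1[of xs ys zs]
    by auto
  have "{zs. construction_sequence (V \<union> V', E \<union> E') zs} =
      (\<Union>(xs, ys)\<in>?C \<times> ?D. shuffles xs ys)" (is "?A = ?B")
  proof
    show "?A \<subseteq> ?B"
    proof
      fix zs assume zs: "zs \<in> ?A"
      then have "filter (\<lambda>x. x \<in> ?S) zs \<in> ?C" "filter (\<lambda>x. x \<notin> ?S) zs \<in> ?D"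
        using ST by (auto simp: construction_sequence_iff_sorted un sorted_wrt_filter)
      then show "zs \<in> ?B"
        using partition_in_shuffles[of zs "\<lambda>x. x \<in> ?S"] by blast
    qed
    show "?B \<subseteq> ?A"
    proof clarify
      fix xs ys zs
      assume *: "construction_sequence (V, E) xs" "construction_sequence (V', E') ys"
        "zs \<in> shuffles xs ys"
      then have "sorted_wrt (\<lambda>x y. \<not> endpoint y x) zs"
        by (intro sorted_wrt_shuffles[of zs xs ys])
          (use cross in \<open>auto simp: construction_sequence_iff_sorted\<close>)
      then show "construction_sequence (V \<union> V', E \<union> E') zs"
        using * ST distinct_disjoint_shuffles[of xs ys zs] set_shuffles[of zs xs ys]
        by (auto simp: construction_sequence_iff_sorted un)
    qed
  qed
  moreover have "card ?B = (\<Sum>(xs, ys)\<in>?C \<times> ?D. card (shuffles xs ys))"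
  proof -
    have "card ?B = (\<Sum>p\<in>?C \<times> ?D. card (case p of (xs, ys) \<Rightarrow> shuffles xs ys))"
    proof (rule card_UN_disjoint)
      show "finite (?C \<times> ?D)"
        using finite_construction_sequences[OF G] finite_construction_sequences[OF H] by simp
      show "\<forall>p\<in>?C \<times> ?D. \<forall>q\<in>?C \<times> ?D. p \<noteq> q \<longrightarrow>
          (case p of (xs, ys) \<Rightarrow> shuffles xs ys) \<inter> (case q of (xs, ys) \<Rightarrow> shuffles xs ys) = {}"
      proof (intro ballI impI)
        fix p q
        assume pq: "p \<in> ?C \<times> ?D" "q \<in> ?C \<times> ?D" "p \<noteq> q"
        obtain xs ys where p: "p = (xs, ys)" "set xs = ?S" "set ys = ?T"
          using pq(1) by (auto simp: construction_sequence_iff_sorted)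
        obtain xs' ys' where q: "q = (xs', ys')" "set xs' = ?S" "set ys' = ?T"
          using pq(2) by (auto simp: construction_sequence_iff_sorted)
        \<comment> \<open>a common shuffle determines both components of the pair, by filtering\<close>
        have False if "zs \<in> shuffles xs ys" "zs \<in> shuffles xs' ys'" for zs
          using filt[OF that(1) p(2,3)] filt[OF that(2) q(2,3)] p(1) q(1) pq(3) by simp
        then show "(case p of (xs, ys) \<Rightarrow> shuffles xs ys) \<inter>
            (case q of (xs, ys) \<Rightarrow> shuffles xs ys) = {}"
          using p(1) q(1) by auto
      qed
    qed auto
    then show ?thesis
      by (simp add: case_prod_unfold)
  qed
  moreover have "(\<Sum>(xs, ys)\<in>?C \<times> ?D. card (shuffles xs ys)) = (\<Sum>_\<in>?C \<times> ?D. ?N)"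
  proof (rule sum.cong[OF refl], clarify)
    fix xs ys
    assume *: "construction_sequence (V, E) xs" "construction_sequence (V', E') ys"
    then have "set xs \<inter> set ys = {}"
      using ST by (simp add: construction_sequence_iff_sorted)
    then show "card (shuffles xs ys) = ?N"
      using length_construction_sequence[OF G *(1)] length_construction_sequence[OF H *(2)]
      by (simp add: card_disjoint_shuffles add.assoc)
  qed
  ultimately show ?thesis
    by (simp add: construction_number_def card_cartesian_product)
qed

text \<open>A vertex cannot come last, since some edge at it must still follow. An edge, on the other
  hand, is required before nothing else, so each edge can be appended to every construction
  sequence of the remaining graph. Without edges the only covered vertex set is empty; the empty
  graph has one construction sequence while the sum is \<open>0\<close>, hence the assumption
  \<open>E \<noteq> {}\<close>.\<close>

lemma construction_number_last_edge:
  assumes G: "simple_graph (V, E)" and ne: "E \<noteq> {}" and cov: "V \<subseteq> \<Union>E"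
  shows "construction_number (V, E) = (\<Sum>e\<in>E. construction_number (V, E - {e}))"
proof -
  let ?C = "\<lambda>E. {xs. construction_sequence (V, E) xs}"
  have el: "elements (V, E) = insert (Inr e) (elements (V, E - {e}))"
      "Inr e \<notin> elements (V, E - {e})" if "e \<in> E" for e
    using that by (auto simp: elements_def)
  have "?C E = (\<Union>e\<in>E. (\<lambda>xs. xs @ [Inr e]) ` ?C (E - {e}))" (is "_ = ?B")
  proof
    show "?C E \<subseteq> ?B"
    proof
      fix zs assume "zs \<in> ?C E"
      then have zs: "distinct zs" "set zs = elements (V, E)"
          "sorted_wrt (\<lambda>x y. \<not> endpoint y x) zs"
        by (auto simp: construction_sequence_iff_sorted)
      have "zs \<noteq> []"
        using zs(2) ne by (auto simp: elements_def)
      then obtain xs z where z: "zs = xs @ [z]"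
        by (metis append_butlast_last_id)
      have "z \<in> elements (V, E)"
        unfolding zs(2)[symmetric] z by simp
      obtain e where e: "z = Inr e" "e \<in> E"
      proof (cases z)
        case (Inl v)
        then have "v \<in> V"
          using \<open>z \<in> elements (V, E)\<close> by (auto simp: elements_def)
        then obtain e where e: "e \<in> E" "v \<in> e"
          using cov by auto
        then have "Inr e \<in> set zs"
          unfolding zs(2) by (auto simp: elements_def)
        then have "Inr e \<in> set xs"
          using z Inl by simp
        moreover have "endpoint z (Inr e)"
          using Inl e by (simp add: endpoint_def)
        ultimately show ?thesis
          using zs(3) unfolding z by (auto simp: sorted_wrt_append)
      next
        case (Inr e)
        then show ?thesis
          using that \<open>z \<in> elements (V, E)\<close> by (auto simp: elements_def)
      qed
      have "set xs = elements (V, E - {e})"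
        using zs(1,2) el[OF e(2)] unfolding z e(1) by (simp add: insert_ident)
      then have "xs \<in> ?C (E - {e})"
        using zs(1,3) unfolding z by (simp add: construction_sequence_iff_sorted sorted_wrt_append)
      then show "zs \<in> ?B"
        using e z by auto
    qed
    show "?B \<subseteq> ?C E"
      by (auto simp: construction_sequence_iff_sorted sorted_wrt_append el endpoint_def)
  qed
  moreover have "card ?B = (\<Sum>e\<in>E. card ((\<lambda>xs. xs @ [Inr e]) ` ?C (E - {e})))"
  proof (rule card_UN_disjoint)
    show "finite E"
      using finite_edges[OF G] by simp
    have "simple_graph (V, E - {e})" for e
      using G by (auto simp: simple_graph_def)
    then show "\<forall>e\<in>E. finite ((\<lambda>xs. xs @ [Inr e]) ` ?C (E - {e}))"
      using finite_construction_sequences by blast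
  qed auto
  ultimately show ?thesis
    by (simp add: construction_number_def card_image inj_on_def)
qed

lemma construction_number_singleton: "construction_number ({v}, {}) = 1"
proof -
  have "{xs. construction_sequence ({v}, {}) xs} = {[Inl v]}"
  proof (intro equalityI subsetI)
    fix xs assume "xs \<in> {xs. construction_sequence ({v}, {}) xs}"
    then have "distinct xs" "set xs = {Inl v}"
      by (auto simp: construction_sequence_def elements_def)
    then show "xs \<in> {[Inl v]}"
      by (cases xs) (auto simp: subset_singleton_iff)
  qed (auto simp: construction_sequence_def elements_def)
  then show ?thesis
    by (simp add: construction_number_def)
qed

lemma construction_number_isolated_vertex:
  assumes "simple_graph (V, E)" "u \<notin> V"
  shows "construction_number (insert u V, E) =
    (card V + card E + 1) * construction_number (V, E)"
  using construction_number_vertex_disjoint_union[OF assms(1), of "{u}" "{}"] assms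
  by (simp add: simple_graph_def construction_number_singleton)

text \<open>The graph on the left is \<open>G\<close> with a new leaf \<open>u\<close> attached at
  \<open>h\<close>, after the edge to this leaf has been deleted again: the summand that the last-edge
  principle produces for a leaf of a star or a double star.\<close>

lemma construction_number_delete_pendant_edge:
  assumes G: "simple_graph G" and u: "u \<notin> fst G"
  shows "construction_number (insert u (fst G), insert {h, u} (snd G) - {{h, u}}) =
    (card (fst G) + card (snd G) + 1) * construction_number G"
proof -
  have "{h, u} \<notin> snd G"
    using assms by (auto simp: simple_graph_def)
  then show ?thesis
    using construction_number_isolated_vertex[of "fst G" "snd G" u] assms by simp
qed

section \<open>Stars\<close>

text \<open>Stars with an arbitrary finite set of leaves: deleting any leaf again gives such a star, so
  the recursion needs no renumbering.\<close>

definition star_at :: "'v \<Rightarrow> 'v set \<Rightarrow> 'v graph" where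
  "star_at h L = (insert h L, (\<lambda>l. {h, l}) ` L)"

lemma inj_on_pair: "h \<notin> L \<Longrightarrow> inj_on (\<lambda>l. {h, l}) L"
  by (auto simp: inj_on_def doubleton_eq_iff)

lemma simple_graph_star_at: "finite L \<Longrightarrow> h \<notin> L \<Longrightarrow> simple_graph (star_at h L)"
  by (auto simp: simple_graph_def star_at_def card_insert_if)

lemma card_star_at:
  assumes "finite L" "h \<notin> L"
  shows "card (fst (star_at h L)) = card L + 1" "card (snd (star_at h L)) = card L"
  using assms by (simp_all add: star_at_def card_image inj_on_pair)

text \<open>If the edge to the leaf \<open>l\<close> comes last, the rest is the star without
  \<open>l\<close>, which has \<open>2 * n + 1\<close> elements for \<open>n + 1\<close> leaves, with
  \<open>l\<close> inserted at one of \<open>2 * n + 2\<close> places. There are \<open>n + 1\<close>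
  choices of \<open>l\<close>.\<close>

lemma construction_number_star_at:
  assumes "finite L" "h \<notin> L"
  shows "construction_number (star_at h L) = 2 ^ card L * (fact (card L))\<^sup>2"
  using assms
proof (induction "card L" arbitrary: L)
  case 0
  then show ?case
    by (simp add: star_at_def construction_number_singleton)
next
  case (Suc n)
  let ?V = "insert h L" and ?E = "(\<lambda>l. {h, l}) ` L"
  have step: "construction_number (?V, ?E - {{h, l}}) =
      (2 * n + 2) * (2 ^ n * (fact n)\<^sup>2)" if l: "l \<in> L" for l
  proof -
    let ?G = "star_at h (L - {l})"
    have "?V = insert l (fst ?G)" "?E = insert {h, l} (snd ?G)" "l \<notin> fst ?G"
      using l \<open>h \<notin> L\<close> by (auto simp: star_at_def)
    moreover have "card (L - {l}) = n"
      using Suc l by simp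
    ultimately show ?thesis
      using construction_number_delete_pendant_edge[of ?G l h] Suc.hyps(1)[of "L - {l}"] Suc.prems
      by (simp add: simple_graph_star_at card_star_at)
  qed
  have "construction_number (star_at h L) = (\<Sum>e\<in>?E. construction_number (?V, ?E - {e}))"
    unfolding star_at_def using simple_graph_star_at[OF Suc.prems] Suc.hyps(2)
    by (intro construction_number_last_edge) (auto simp: star_at_def)
  also have "\<dots> = (\<Sum>l\<in>L. construction_number (?V, ?E - {{h, l}}))"
    using Suc.prems by (simp add: sum.reindex inj_on_pair)
  also have "\<dots> = Suc n * ((2 * n + 2) * (2 ^ n * (fact n)\<^sup>2))"
    using Suc.hyps(2) by (simp add: step)
  also have "\<dots> = 2 ^ card L * (fact (card L))\<^sup>2"
    unfolding Suc.hyps(2)[symmetric] by (simp add: power2_eq_square algebra_simps)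
  finally show ?case .
qed

lemma star_eq_star_at: "star n = star_at Hub (Leaf ` {..<n})"
  by (auto simp: star_def star_at_def)

lemma construction_number_star: "construction_number (star n) = 2 ^ n * (fact n)\<^sup>2"
  by (simp add: star_eq_star_at construction_number_star_at card_image inj_on_def image_iff)

lemma card_star: "card (fst (star n)) = n + 1" "card (snd (star n)) = n"
  by (simp_all add: star_eq_star_at card_star_at card_image inj_on_def image_iff)

lemma construction_number_disjoint_union:
  assumes G: "simple_graph G" and H: "simple_graph H"
  shows "construction_number (disjoint_union G H) =
     ((card (fst G) + card (snd G) + card (fst H) + card (snd H)) choose
        (card (fst G) + card (snd G)))
     * construction_number G * construction_number H"
proof -
  obtain V E where GV: "G = (V, E)" by (cases G)
  obtain W F where HW: "H = (W, F)" by (cases H)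
  have sub: "e \<subseteq> V" if "e \<in> E" for e
    using G that by (auto simp: GV simple_graph_def)
  have sub': "e \<subseteq> W" if "e \<in> F" for e
    using H that by (auto simp: HW simple_graph_def)
  have "simple_graph (Inl ` V :: ('a + 'b) set, (`) Inl ` E)"
    "simple_graph (Inr ` W :: ('a + 'b) set, (`) Inr ` F)"
    using G H by (fastforce simp: GV HW simple_graph_def card_image)+
  moreover have "card ((`) (Inl :: 'a \<Rightarrow> 'a + 'b) ` E) = card E"
    "card ((`) (Inr :: 'b \<Rightarrow> 'a + 'b) ` F) = card F"
    by (simp_all add: card_image inj_on_def inj_image_eq_iff)
  moreover have "construction_number (Inl ` V :: ('a + 'b) set, (`) Inl ` E) = construction_number G"
    "construction_number (Inr ` W :: ('a + 'b) set, (`) Inr ` F) = construction_number H"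
    unfolding GV HW by (rule construction_number_image; use sub sub' in auto)+
  moreover have "disjoint_union G H = (Inl ` V \<union> Inr ` W, (`) Inl ` E \<union> (`) Inr ` F)"
    by (auto simp: disjoint_union_def GV HW)
  ultimately show ?thesis
    using construction_number_vertex_disjoint_union[of "Inl ` V :: ('a + 'b) set" "(`) Inl ` E"
        "Inr ` W" "(`) Inr ` F"]
    by (auto simp: GV HW card_image)
qed

section \<open>Double stars\<close>

text \<open>Deleting the leaf \<open>LeafV i\<close> from \<open>double_star a b\<close> can leave a gap in the
  numbering of the leaves. Allowing arbitrary index sets gives the remaining graph a name;
  \<open>construction_number_double_star_on\<close> closes the gap by renaming.\<close>

definition double_star_on :: "nat set \<Rightarrow> nat set \<Rightarrow> double_star_vertex graph" where
  "double_star_on A B =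
     ({HubV, HubW} \<union> LeafV ` A \<union> LeafW ` B,
      {{HubV, HubW}} \<union> (\<lambda>i. {HubV, LeafV i}) ` A \<union> (\<lambda>i. {HubW, LeafW i}) ` B)"

lemma double_star_eq_on: "double_star a b = double_star_on {..<a} {..<b}"
  by (auto simp: double_star_def double_star_on_def)

lemma simple_graph_double_star_on:
  "finite A \<Longrightarrow> finite B \<Longrightarrow> simple_graph (double_star_on A B)"
  by (auto simp: simple_graph_def double_star_on_def)

lemma card_double_star_on:
  assumes "finite A" "finite B"
  shows "card (fst (double_star_on A B)) = card A + card B + 2"
    and "card (snd (double_star_on A B)) = card A + card B + 1"
proof -
  have "card (LeafV ` A \<union> LeafW ` B) = card A + card B"
    using assms by (subst card_Un_disjoint) (auto simp: card_image inj_on_def)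
  moreover have "fst (double_star_on A B) = insert HubV (insert HubW (LeafV ` A \<union> LeafW ` B))"
    by (auto simp: double_star_on_def)
  ultimately show "card (fst (double_star_on A B)) = card A + card B + 2"
    using assms by (auto simp: card_insert_if)
  have "card ((\<lambda>i. {HubV, LeafV i}) ` A \<union> (\<lambda>i. {HubW, LeafW i}) ` B) = card A + card B"
    using assms by (subst card_Un_disjoint) (auto simp: card_image inj_on_def doubleton_eq_iff)
  moreover have "snd (double_star_on A B) =
      insert {HubV, HubW} ((\<lambda>i. {HubV, LeafV i}) ` A \<union> (\<lambda>i. {HubW, LeafW i}) ` B)"
    by (auto simp: double_star_on_def)
  ultimately show "card (snd (double_star_on A B)) = card A + card B + 1"
    using assms by (auto simp: card_insert_if doubleton_eq_iff)
qed

lemma construction_number_double_star_on: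
  assumes "finite A" "finite B"
  shows "construction_number (double_star_on A B) = construction_number (double_star (card A) (card B))"
proof -
  obtain p where p: "bij_betw p A {..<card A}"
    using ex_bij_betw_finite_nat[OF assms(1)] by (auto simp: atLeast0LessThan)
  obtain q where q: "bij_betw q B {..<card B}"
    using ex_bij_betw_finite_nat[OF assms(2)] by (auto simp: atLeast0LessThan)
  define f where "f x = (case x of LeafV i \<Rightarrow> LeafV (p i) | LeafW i \<Rightarrow> LeafW (q i) | _ \<Rightarrow> x)" for x
  have f: "f HubV = HubV" "f HubW = HubW" "f (LeafV i) = LeafV (p i)" "f (LeafW i) = LeafW (q i)" for i
    by (auto simp: f_def)
  let ?V = "fst (double_star_on A B)" and ?E = "snd (double_star_on A B)"
  have "(f ` ?V, (`) f ` ?E) = double_star_on (p ` A) (q ` B)"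
    by (simp add: double_star_on_def f image_Un image_image)
  also have "\<dots> = double_star (card A) (card B)"
    using p q by (simp add: bij_betw_def double_star_eq_on)
  finally have "construction_number (double_star (card A) (card B)) =
      construction_number (f ` ?V, (`) f ` ?E)"
    by simp
  also have "\<dots> = construction_number (?V, ?E)"
  proof (rule construction_number_image)
    show "inj_on f ?V"
      using p q by (auto simp: bij_betw_def double_star_on_def f inj_on_def)
    show "e \<subseteq> ?V" if "e \<in> ?E" for e
      using that simple_graph_double_star_on[OF assms] by (auto simp: simple_graph_def)
  qed
  finally show ?thesis
    by simp
qed

text \<open>The two graphs differ only in the names of their vertices.\<close>

lemma construction_number_delete_hub_edge:
  "construction_number (fst (double_star a b), snd (double_star a b) - {{HubV, HubW}}) =
     construction_number (disjoint_union (star a) (star b))"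
proof -
  define f where "f x = (case x of Inl Hub \<Rightarrow> HubV | Inl (Leaf i) \<Rightarrow> LeafV i
    | Inr Hub \<Rightarrow> HubW | Inr (Leaf i) \<Rightarrow> LeafW i)" for x
  have f: "f (Inl Hub) = HubV" "f (Inl (Leaf i)) = LeafV i"
    "f (Inr Hub) = HubW" "f (Inr (Leaf i)) = LeafW i" for i
    by (auto simp: f_def)
  let ?G = "disjoint_union (star a) (star b)"
  have V: "f ` fst ?G = fst (double_star a b)"
    by (auto simp: disjoint_union_def star_def double_star_def f image_Un image_image Plus_def)
  have E: "snd (double_star a b) - {{HubV, HubW}} =
      (\<lambda>i. {HubV, LeafV i}) ` {..<a} \<union> (\<lambda>i. {HubW, LeafW i}) ` {..<b}"
    by (auto simp: double_star_def doubleton_eq_iff)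
  have "(`) f ` snd ?G = snd (double_star a b) - {{HubV, HubW}}"
    unfolding E
    by (auto simp: disjoint_union_def star_eq_star_at star_at_def f image_Un image_image)
  with V have "construction_number (fst (double_star a b), snd (double_star a b) - {{HubV, HubW}}) =
      construction_number (f ` fst ?G, (`) f ` snd ?G)"
    by simp
  also have "\<dots> = construction_number (fst ?G, snd ?G)"
  proof (rule construction_number_image)
    show "inj_on f (fst ?G)"
      by (auto simp: inj_on_def f_def split: sum.splits star_vertex.splits)
    show "e \<subseteq> fst ?G" if "e \<in> snd ?G" for e
      using that simple_graph_disjoint_union[OF simple_graph_star simple_graph_star, of a b]
      by (auto simp: simple_graph_def)
  qed
  finally show ?thesis
    by simp
qed

lemma construction_number_delete_leaf_edge_V:
  assumes "i < a"
  shows "construction_number (fst (double_star a b), snd (double_star a b) - {{HubV, LeafV i}}) =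
    (2 * a + 2 * b + 2) * construction_number (double_star (a - 1) b)"
proof -
  let ?G = "double_star_on ({..<a} - {i}) {..<b}"
  have "fst (double_star a b) = insert (LeafV i) (fst ?G)"
    "snd (double_star a b) = insert {HubV, LeafV i} (snd ?G)"
    using assms by (auto simp: double_star_eq_on double_star_on_def)
  moreover have "LeafV i \<notin> fst ?G"
    by (auto simp: double_star_on_def)
  ultimately show ?thesis
    using construction_number_delete_pendant_edge[of ?G "LeafV i" HubV] assms
    by (simp add: simple_graph_double_star_on card_double_star_on construction_number_double_star_on)
qed

lemma construction_number_delete_leaf_edge_W:
  assumes "i < b"
  shows "construction_number (fst (double_star a b), snd (double_star a b) - {{HubW, LeafW i}}) =
    (2 * a + 2 * b + 2) * construction_number (double_star a (b - 1))"
proof -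
  let ?G = "double_star_on {..<a} ({..<b} - {i})"
  have "fst (double_star a b) = insert (LeafW i) (fst ?G)"
    "snd (double_star a b) = insert {HubW, LeafW i} (snd ?G)"
    using assms by (auto simp: double_star_eq_on double_star_on_def)
  moreover have "LeafW i \<notin> fst ?G"
    by (auto simp: double_star_on_def)
  ultimately show ?thesis
    using construction_number_delete_pendant_edge[of ?G "LeafW i" HubW] assms
    by (simp add: simple_graph_double_star_on card_double_star_on construction_number_double_star_on)
qed

theorem theorem2:
  fixes a b :: nat
  shows "construction_number (double_star a b) =
           construction_number (disjoint_union (star a) (star b))
           + beta a b * construction_number (double_star (a - 1) b)
           + beta b a * construction_number (double_star a (b - 1))
         \<and> construction_number (disjoint_union (star a) (star b)) =
           ((2 * a + 2 * b + 2) choose (2 * a + 1))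
           * (2 ^ a * (fact a) ^ 2) * (2 ^ b * (fact b) ^ 2)"
proof
  let ?V = "fst (double_star a b)" and ?E = "snd (double_star a b)"
  let ?c = "\<lambda>e. construction_number (?V, ?E - {e})"
  let ?A = "(\<lambda>i. {HubV, LeafV i}) ` {..<a}" and ?B = "(\<lambda>i. {HubW, LeafW i}) ` {..<b}"
  have E: "?E = insert {HubV, HubW} (?A \<union> ?B)"
    by (auto simp: double_star_def)
  have "construction_number (?V, ?E) = (\<Sum>e\<in>?E. ?c e)"
  proof (rule construction_number_last_edge)
    show "simple_graph (?V, ?E)"
      using simple_graph_double_star[of a b] by simp
    show "?V \<subseteq> \<Union>?E"
      unfolding E by (auto simp: double_star_def)
  qed (simp add: E)
  also have "\<dots> = ?c {HubV, HubW} + ((\<Sum>e\<in>?A. ?c e) + (\<Sum>e\<in>?B. ?c e))"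
  proof -
    have "sum ?c (insert {HubV, HubW} (?A \<union> ?B)) = ?c {HubV, HubW} + sum ?c (?A \<union> ?B)"
      by (rule sum.insert) (auto simp: doubleton_eq_iff)
    also have "sum ?c (?A \<union> ?B) = sum ?c ?A + sum ?c ?B"
      by (rule sum.union_disjoint) (auto simp: doubleton_eq_iff)
    finally show ?thesis
      by (simp only: E[symmetric])
  qed
  also have "(\<Sum>e\<in>?A. ?c e) = (\<Sum>i<a. ?c {HubV, LeafV i})"
    by (subst sum.reindex) (auto simp: inj_on_def doubleton_eq_iff)
  also have "\<dots> = beta a b * construction_number (double_star (a - 1) b)"
    by (simp add: construction_number_delete_leaf_edge_V beta_def algebra_simps)
  also have "(\<Sum>e\<in>?B. ?c e) = (\<Sum>i<b. ?c {HubW, LeafW i})"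
    by (subst sum.reindex) (auto simp: inj_on_def doubleton_eq_iff)
  also have "\<dots> = beta b a * construction_number (double_star a (b - 1))"
    by (simp add: construction_number_delete_leaf_edge_W beta_def algebra_simps)
  finally show "construction_number (double_star a b) =
           construction_number (disjoint_union (star a) (star b))
           + beta a b * construction_number (double_star (a - 1) b)
           + beta b a * construction_number (double_star a (b - 1))"
    by (simp add: construction_number_delete_hub_edge)
  have "a + 1 + a + (b + 1) + b = 2 * a + 2 * b + 2" "a + 1 + a = 2 * a + 1"
    by simp_all
  then show "construction_number (disjoint_union (star a) (star b)) =
           ((2 * a + 2 * b + 2) choose (2 * a + 1))
           * (2 ^ a * (fact a) ^ 2) * (2 ^ b * (fact b) ^ 2)"
    using construction_number_disjoint_union[OF simple_graph_star simple_graph_star, of a b]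
    by (simp only: card_star construction_number_star)
qed

end
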